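(* Let $\Lambda=(V,E)$ be a finite graph and let $J=(J_{xy})_{xy\in E}$ with $J_{xy}\in(0,\infty)$ be coupling constants. Let $\langle\cdot\rangle_{J,\Lambda}$ denote the expectation of the XY model on $\Lambda$ with coupling constants $J$. Then for all functions $\varphi,\psi:V\to\mathbb{Z}$ with $\sum_{v\in V}\varphi_v=\sum_{v\in V}\psi_v=0$, one has $$\langle \sigma^{\varphi+\psi}\rangle_{J,\Lambda}+\langle \sigma^{\varphi-\psi}\rangle_{J,\Lambda}\ \geq\ 2\,\langle\sigma^{\varphi}\rangle_{J,\Lambda}\,\langle\sigma^{\psi}\rangle_{J,\Lambda}.$$ Equivalently (since $\sigma^{\varphi}+\sigma^{-\varphi}=2\cos(\varphi\cdot\theta)$), $$\langle \cos(\varphi\cdot\theta)\cos(\psi\cdot\theta)\rangle_{J,\Lambda}\ \geq\ \langle\cos(\varphi\cdot\theta)\rangle_{J,\Lambda}\,\langle\cos(\psi\cdot\theta)\rangle_{J,\Lambda}.$$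
   Context: Let $S^1=\{z\in\mathbb{C}:|z|=1\}$. For $\sigma=(\sigma_x)_{x\in V}\in(S^1)^V$, the XY Hamiltonian is $$H(\sigma)=-\sum_{xy\in E}J_{xy}\,\sigma_x\cdot\sigma_y=-\sum_{xy\in E}\frac{J_{xy}}{2}\left(\sigma_x\bar\sigma_y+\bar\sigma_x\sigma_y\right),$$ where $\sigma_x\cdot\sigma_y$ is the Euclidean inner product in $\mathbb{C}\cong\mathbb{R}^2$. The Gibbs measure is the probability measure on $(S^1)^V$ given by $$d\mu_{J,\Lambda}(\sigma)=\frac{1}{\mathcal{Z}_{J,\Lambda}}e^{-H(\sigma)}\,d\sigma,\qquad \mathcal{Z}_{J,\Lambda}=\int_{(S^1)^V}e^{-H(\sigma)}\,d\sigma,$$ where $d\sigma=\prod_{x\in V}d\sigma_x$ is the uniform probability measure on $(S^1)^V$ (product of the uniform probability measures on $S^1$). The expectation with respect to $\mu_{J,\Lambda}$ is denoted $\langle\cdot\rangle_{J,\Lambda}$. For $\varphi:V\to\mathbb{Z}$, write $\sigma^{\varphi}=\prod_{x\in V}\sigma_x^{\varphi_x}$. For $\sigma\in(S^1)^V$, let $\theta=(\theta_x)_{x\in V}\in[0,2\pi)^V$ be determined by $\sigma_x=e^{i\theta_x}$, and write $\varphi\cdot\theta=\sum_{x\in V}\varphi_x\theta_x$. *)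

theory Defs
  imports "HOL-Probability.Probability" "HOL-Library.Complex_Order"
begin

definition finite_graph :: "'v set \<Rightarrow> 'v set set \<Rightarrow> bool" where
  "finite_graph V E \<longleftrightarrow> finite V \<and> (\<forall>e\<in>E. e \<subseteq> V \<and> card e = 2)"

text \<open>The inner product of the two spins at the ends of an unordered edge; it is well defined
  because the inner product is symmetric.\<close>

definition edge_inner :: "('v \<Rightarrow> complex) \<Rightarrow> 'v set \<Rightarrow> real" where
  "edge_inner \<sigma> e = (THE r. \<exists>x y. e = {x, y} \<and> r = \<sigma> x \<bullet> \<sigma> y)"

lemma edge_inner_doubleton: "edge_inner \<sigma> {x, y} = \<sigma> x \<bullet> \<sigma> y"
  unfolding edge_inner_def by (rule the_equality) (auto simp: doubleton_eq_iff inner_commute)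

lemma finite_graph_edgeE:
  assumes "finite_graph V E" "e \<in> E"
  obtains x y where "e = {x, y}" "x \<in> V" "y \<in> V"
proof -
  have "card e = 2" "e \<subseteq> V"
    using assms by (simp_all add: finite_graph_def)
  then obtain x y where "e = {x, y}"
    by (meson card_2_iff)
  with \<open>e \<subseteq> V\<close> show thesis
    by (intro that) auto
qed

definition xy_hamiltonian :: "'v set set \<Rightarrow> ('v set \<Rightarrow> real) \<Rightarrow> ('v \<Rightarrow> complex) \<Rightarrow> real" where
  "xy_hamiltonian E J \<sigma> = - (\<Sum>e\<in>E. J e * edge_inner \<sigma> e)"

definition circle_uniform :: "complex measure" where
  "circle_uniform =
     distr (uniform_measure lborel {0..<2 * pi}) (restrict_space borel (sphere 0 1)) cis"

definition spin_uniform :: "'v set \<Rightarrow> ('v \<Rightarrow> complex) measure" where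
  "spin_uniform V = Pi\<^sub>M V (\<lambda>_. circle_uniform)"

definition xy_partition :: "'v set \<Rightarrow> 'v set set \<Rightarrow> ('v set \<Rightarrow> real) \<Rightarrow> real" where
  "xy_partition V E J = (\<integral>\<sigma>. exp (- xy_hamiltonian E J \<sigma>) \<partial>spin_uniform V)"

definition xy_gibbs :: "'v set \<Rightarrow> 'v set set \<Rightarrow> ('v set \<Rightarrow> real) \<Rightarrow> ('v \<Rightarrow> complex) measure" where
  "xy_gibbs V E J =
     density (spin_uniform V)
       (\<lambda>\<sigma>. ennreal (exp (- xy_hamiltonian E J \<sigma>) / xy_partition V E J))"

text \<open>Expectations of complex observables are compared in the order of
  \<^theory>\<open>HOL-Library.Complex_Order\<close>: \<open>a \<le> b\<close> iff \<open>b - a\<close> is a nonnegative real.\<close>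

definition xy_expectation ::
  "'v set \<Rightarrow> 'v set set \<Rightarrow> ('v set \<Rightarrow> real) \<Rightarrow>
   (('v \<Rightarrow> complex) \<Rightarrow> 'b::{banach, second_countable_topology}) \<Rightarrow> 'b" where
  "xy_expectation V E J f = (\<integral>\<sigma>. f \<sigma> \<partial>xy_gibbs V E J)"

definition spin_monomial :: "'v set \<Rightarrow> ('v \<Rightarrow> int) \<Rightarrow> ('v \<Rightarrow> complex) \<Rightarrow> complex" where
  "spin_monomial V \<phi> \<sigma> = (\<Prod>x\<in>V. \<sigma> x powi \<phi> x)"

text \<open>The angle of a spin is taken in \<open>[0, 2\<pi>)\<close>, which is the range of \<^const>\<open>Arg2pi\<close>.\<close>

definition angle_pairing :: "'v set \<Rightarrow> ('v \<Rightarrow> int) \<Rightarrow> ('v \<Rightarrow> complex) \<Rightarrow> real" where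
  "angle_pairing V \<phi> \<sigma> = (\<Sum>x\<in>V. of_int (\<phi> x) * Arg2pi (\<sigma> x))"

lemma space_circle_uniform [simp]: "space circle_uniform = sphere 0 1"
  by (simp add: circle_uniform_def space_restrict_space)

lemma sets_circle_uniform [measurable_cong]:
  "sets circle_uniform = sets (restrict_space borel (sphere 0 1))"
  by (simp add: circle_uniform_def)

lemma prob_space_circle_uniform: "prob_space circle_uniform"
  unfolding circle_uniform_def
proof (rule prob_space.prob_space_distr)
  show "prob_space (uniform_measure lborel {0..<2 * pi})"
    by (rule prob_space_uniform_measure) auto
  have "cis \<in> borel_measurable borel"
    by (intro borel_measurable_continuous_onI continuous_intros)
  then show "cis \<in> uniform_measure lborel {0..<2 * pi} \<rightarrow>\<^sub>M restrict_space borel (sphere 0 1)"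
    by (intro measurable_restrict_space2) auto
qed

lemma prob_space_spin_uniform: "prob_space (spin_uniform V)"
  unfolding spin_uniform_def by (intro prob_space_PiM prob_space_circle_uniform)

lemma space_spin_uniform: "space (spin_uniform V) = (\<Pi>\<^sub>E x\<in>V. sphere 0 1)"
  by (simp add: spin_uniform_def space_PiM)

lemma measurable_spin:
  assumes "x \<in> V"
  shows "(\<lambda>\<sigma>. \<sigma> x) \<in> borel_measurable (spin_uniform V)"
proof -
  have "(\<lambda>\<sigma>. \<sigma> x) \<in> spin_uniform V \<rightarrow>\<^sub>M circle_uniform"
    unfolding spin_uniform_def by (rule measurable_component_singleton[OF assms])
  also have "(spin_uniform V \<rightarrow>\<^sub>M circle_uniform) =
      (spin_uniform V \<rightarrow>\<^sub>M restrict_space borel (sphere 0 1))"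
    by (rule measurable_cong_sets) (simp_all add: sets_circle_uniform)
  finally show ?thesis
    by (simp add: measurable_restrict_space2_iff)
qed

lemma xy_hamiltonian_measurable:
  assumes "finite_graph V E"
  shows "xy_hamiltonian E J \<in> borel_measurable (spin_uniform V)"
proof -
  have "(\<lambda>\<sigma>. edge_inner \<sigma> e) \<in> borel_measurable (spin_uniform V)" if "e \<in> E" for e
  proof -
    obtain x y where e: "e = {x, y}" and "x \<in> V" "y \<in> V"
      using assms \<open>e \<in> E\<close> by (rule finite_graph_edgeE)
    then show ?thesis
      unfolding e edge_inner_doubleton by (intro borel_measurable_inner measurable_spin)
  qed
  then show ?thesis
    unfolding xy_hamiltonian_def[abs_def]
    by (intro borel_measurable_uminus borel_measurable_sum borel_measurable_times) auto
qed

lemma xy_hamiltonian_bound: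
  assumes "finite_graph V E" "\<sigma> \<in> space (spin_uniform V)"
  shows "\<bar>xy_hamiltonian E J \<sigma>\<bar> \<le> (\<Sum>e\<in>E. \<bar>J e\<bar>)"
proof -
  have "\<bar>J e * edge_inner \<sigma> e\<bar> \<le> \<bar>J e\<bar>" if "e \<in> E" for e
  proof -
    obtain x y where e: "e = {x, y}" and "x \<in> V" "y \<in> V"
      using assms(1) \<open>e \<in> E\<close> by (rule finite_graph_edgeE)
    then have "norm (\<sigma> x) = 1" "norm (\<sigma> y) = 1"
      using assms(2) by (auto simp: space_spin_uniform PiE_iff)
    then have "\<bar>\<sigma> x \<bullet> \<sigma> y\<bar> \<le> 1"
      using Cauchy_Schwarz_ineq2[of "\<sigma> x" "\<sigma> y"] by simp
    then show ?thesis
      unfolding e edge_inner_doubleton by (simp add: abs_mult mult_left_le)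
  qed
  then show ?thesis
    unfolding xy_hamiltonian_def abs_minus_cancel
    by (intro order_trans[OF sum_abs] sum_mono)
qed

lemma xy_boltzmann_bounds:
  assumes "finite_graph V E" "\<sigma> \<in> space (spin_uniform V)"
  shows "exp (- (\<Sum>e\<in>E. \<bar>J e\<bar>)) \<le> exp (- xy_hamiltonian E J \<sigma>)"
    and "exp (- xy_hamiltonian E J \<sigma>) \<le> exp (\<Sum>e\<in>E. \<bar>J e\<bar>)"
  using xy_hamiltonian_bound[OF assms, of J] by simp_all

lemma xy_boltzmann_integrable:
  assumes "finite_graph V E"
  shows "integrable (spin_uniform V) (\<lambda>\<sigma>. exp (- xy_hamiltonian E J \<sigma>))"
proof -
  interpret prob_space "spin_uniform V" by (rule prob_space_spin_uniform)
  show ?thesis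
  proof (rule integrable_const_bound)
    show "AE \<sigma> in spin_uniform V. norm (exp (- xy_hamiltonian E J \<sigma>)) \<le> exp (\<Sum>e\<in>E. \<bar>J e\<bar>)"
      using xy_boltzmann_bounds(2)[OF assms] by (intro AE_I2) simp
    show "(\<lambda>\<sigma>. exp (- xy_hamiltonian E J \<sigma>)) \<in> borel_measurable (spin_uniform V)"
      using xy_hamiltonian_measurable[OF assms, of J] by measurable
  qed
qed

lemma xy_partition_pos:
  assumes "finite_graph V E"
  shows "xy_partition V E J > 0"
proof -
  interpret prob_space "spin_uniform V" by (rule prob_space_spin_uniform)
  have "exp (- (\<Sum>e\<in>E. \<bar>J e\<bar>)) \<le> xy_partition V E J"
    unfolding xy_partition_def
    using xy_boltzmann_bounds(1)[OF assms]
    by (intro integral_ge_const xy_boltzmann_integrable[OF assms] AE_I2)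
  then show ?thesis
    using exp_gt_zero by (rule less_le_trans[rotated])
qed

lemma prob_space_xy_gibbs:
  assumes "finite_graph V E"
  shows "prob_space (xy_gibbs V E J)"
proof
  let ?f = "\<lambda>\<sigma>. exp (- xy_hamiltonian E J \<sigma>) / xy_partition V E J"
  have int: "integrable (spin_uniform V) ?f"
    by (intro integrable_divide xy_boltzmann_integrable assms)
  have "emeasure (xy_gibbs V E J) (space (xy_gibbs V E J)) = (\<integral>\<^sup>+\<sigma>. ennreal (?f \<sigma>) \<partial>spin_uniform V)"
    unfolding xy_gibbs_def using borel_measurable_integrable[OF int]
    by (subst emeasure_density) (auto intro!: nn_integral_cong simp: indicator_def)
  also have "\<dots> = ennreal (\<integral>\<sigma>. ?f \<sigma> \<partial>spin_uniform V)"
    using int xy_partition_pos[OF assms, of J] by (intro nn_integral_eq_integral) auto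
  also have "(\<integral>\<sigma>. ?f \<sigma> \<partial>spin_uniform V) = 1"
    using xy_partition_pos[OF assms, of J]
    by (simp add: xy_partition_def[symmetric])
  finally show "emeasure (xy_gibbs V E J) (space (xy_gibbs V E J)) = 1" by simp
qed

end

theory Submission
  imports Defs
begin

text \<open>The proof is Ginibre's. For two independent copies \<open>\<theta>\<close>, \<open>\<theta>'\<close> of the model, the covariance of
  \<open>cos (\<phi> \<bullet> \<theta>)\<close> and \<open>cos (\<psi> \<bullet> \<theta>)\<close> is half the expectation of
  \<open>(cos (\<phi> \<bullet> \<theta>) - cos (\<phi> \<bullet> \<theta>')) (cos (\<psi> \<bullet> \<theta>) - cos (\<psi> \<bullet> \<theta>'))\<close>. The substitution
  \<open>\<theta> = \<alpha> + \<beta>\<close>, \<open>\<theta>' = \<alpha> - \<beta>\<close> preserves the uniform measure on pairs of configurations and turns this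
  product into \<open>4 g(\<alpha>) g(\<beta>)\<close> with \<open>g(\<alpha>) = sin (\<phi> \<bullet> \<alpha>) sin (\<psi> \<bullet> \<alpha>)\<close>, and the joint Boltzmann weight into
  \<open>exp (\<Sum>xy. 2 J\<^sub>x\<^sub>y cos (\<alpha>\<^sub>x - \<alpha>\<^sub>y) cos (\<beta>\<^sub>x - \<beta>\<^sub>y))\<close>. Expanding the exponential, every term is a
  nonnegative coefficient times an integral of the form \<open>\<integral>\<integral> f(\<alpha>) f(\<beta>) = (\<integral> f)\<^sup>2\<close>.\<close>

section \<open>Invariance of the uniform measure\<close>

lemma nn_integral_interval_shift:
  fixes f :: "real \<Rightarrow> ennreal"
  assumes [measurable]: "f \<in> borel_measurable borel" and per: "\<And>t. f (t + c) = f t"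
  shows "(\<integral>\<^sup>+t. f t * indicator {a + c..<b + c} t \<partial>lborel) = (\<integral>\<^sup>+t. f t * indicator {a..<b} t \<partial>lborel)"
proof -
  have "(\<integral>\<^sup>+t. f t * indicator {a + c..<b + c} t \<partial>lborel) =
      (\<integral>\<^sup>+t. f (c + t) * indicator {a + c..<b + c} (c + t) \<partial>lborel)"
    by (subst nn_integral_real_affine[where c = 1 and t = c]) simp_all
  also have "\<dots> = (\<integral>\<^sup>+t. f t * indicator {a..<b} t \<partial>lborel)"
    using per by (intro nn_integral_cong) (auto simp: add.commute split: split_indicator)
  finally show ?thesis .
qed

lemma nn_integral_interval_split:
  fixes f :: "real \<Rightarrow> ennreal"
  assumes [measurable]: "f \<in> borel_measurable borel" and "a \<le> b" "b \<le> c"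
  shows "(\<integral>\<^sup>+t. f t * indicator {a..<c} t \<partial>lborel) =
    (\<integral>\<^sup>+t. f t * indicator {a..<b} t \<partial>lborel) + (\<integral>\<^sup>+t. f t * indicator {b..<c} t \<partial>lborel)"
  using assms(2,3)
  by (subst nn_integral_add[symmetric])
     (auto intro!: nn_integral_cong split: split_indicator)

text \<open>The window is cut at the multiple of \<open>p\<close> inside it. Moving the left piece
  forward by \<open>p\<close> reassembles a full period starting at that multiple, which is then
  translated back to 0. Periodicity is assumed for all integer multiples, so that this last
  translation is a single shift.\<close>

lemma nn_integral_period:
  fixes f :: "real \<Rightarrow> ennreal"
  assumes [measurable]: "f \<in> borel_measurable borel"
    and per: "\<And>t (n::int). f (t + of_int n * p) = f t" and "0 < p"
  shows "(\<integral>\<^sup>+t. f t * indicator {a..<a + p} t \<partial>lborel) = (\<integral>\<^sup>+t. f t * indicator {0..<p} t \<partial>lborel)"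
proof -
  let ?I = "\<lambda>a b. \<integral>\<^sup>+t. f t * indicator {a..<b} t \<partial>lborel"
  \<comment> \<open>The ceiling makes \<open>n * p\<close> the unique multiple of \<open>p\<close>
    in the half-open window from \<open>a\<close> to \<open>a + p\<close>.\<close>
  define n where "n = \<lceil>a / p\<rceil>"
  define b where "b = of_int n * p"
  have "a / p \<le> of_int n" "of_int n < a / p + 1"
    unfolding n_def by linarith+
  then have "a / p * p \<le> b" "b < (a / p + 1) * p"
    unfolding b_def using \<open>0 < p\<close> by (simp_all only: mult_right_mono mult_strict_right_mono less_imp_le)
  then have b: "a \<le> b" "b < a + p"
    using \<open>0 < p\<close> by (simp_all add: algebra_simps)
  have "?I a (a + p) = ?I a b + ?I b (a + p)"
    using b by (intro nn_integral_interval_split) auto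
  also have "?I a b = ?I (a + p) (b + p)"
    using per[of _ 1] by (intro nn_integral_interval_shift[symmetric]) auto
  also have "?I (a + p) (b + p) + ?I b (a + p) = ?I b (b + p)"
    using b by (subst nn_integral_interval_split[of _ b "a + p"]) (auto simp: add.commute)
  also have "\<dots> = ?I (0 + b) (p + b)"
    by (simp add: add.commute)
  also have "\<dots> = ?I 0 p"
    using per[of _ n] by (intro nn_integral_interval_shift) (auto simp: b_def)
  finally show ?thesis .
qed

text \<open>The integral of \<open>f\<close> over two periods is computed in two ways: the
  substitution t = 2s gives twice the left-hand side, and splitting in the middle gives twice the
  right-hand side.\<close>

lemma nn_integral_period_double:
  fixes f :: "real \<Rightarrow> ennreal"
  assumes [measurable]: "f \<in> borel_measurable borel"
    and per: "\<And>t (n::int). f (t + of_int n * p) = f t" and "0 < p"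
  shows "(\<integral>\<^sup>+t. f (2 * t) * indicator {0..<p} t \<partial>lborel) = (\<integral>\<^sup>+t. f t * indicator {0..<p} t \<partial>lborel)"
proof -
  let ?I = "\<lambda>a b. \<integral>\<^sup>+t. f t * indicator {a..<b} t \<partial>lborel"
  have "?I 0 (2 * p) = ennreal 2 * (\<integral>\<^sup>+t. f (0 + 2 * t) * indicator {0..<2 * p} (0 + 2 * t) \<partial>lborel)"
    by (subst nn_integral_real_affine[where c = 2 and t = 0]) simp_all
  also have "\<dots> = ennreal 2 * (\<integral>\<^sup>+t. f (2 * t) * indicator {0..<p} t \<partial>lborel)"
    by (intro arg_cong2[where f = "(*)"] nn_integral_cong refl) (auto split: split_indicator)
  finally have *: "?I 0 (2 * p) = ennreal 2 * (\<integral>\<^sup>+t. f (2 * t) * indicator {0..<p} t \<partial>lborel)" .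
  have "?I 0 (2 * p) = ?I 0 p + ?I p (2 * p)"
    using \<open>0 < p\<close> by (intro nn_integral_interval_split) auto
  also have "?I p (2 * p) = ?I p (p + p)"
    by (simp only: mult_2)
  also have "?I p (p + p) = ?I 0 p"
    using assms by (intro nn_integral_period)
  also have "?I 0 p + ?I 0 p = ennreal 2 * ?I 0 p"
    by (simp only: ennreal_numeral mult_2)
  finally show ?thesis
    unfolding * by (simp add: ennreal_mult_cancel_left)
qed

lemma nn_integral_period_reflect:
  fixes f :: "real \<Rightarrow> ennreal"
  assumes [measurable]: "f \<in> borel_measurable borel"
    and per: "\<And>t (n::int). f (t + of_int n * p) = f t" and "0 < p"
  shows "(\<integral>\<^sup>+t. f (- t) * indicator {0..<p} t \<partial>lborel) = (\<integral>\<^sup>+t. f t * indicator {0..<p} t \<partial>lborel)"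
proof -
  have "(\<integral>\<^sup>+t. f (- t) * indicator {0..<p} t \<partial>lborel) =
      (\<integral>\<^sup>+t. f (- (0 + (-1) * t)) * indicator {0..<p} (0 + (-1) * t) \<partial>lborel)"
    by (subst nn_integral_real_affine[where c = "-1" and t = 0]) simp_all
  also have "\<dots> = (\<integral>\<^sup>+t. f t * indicator {- p..<- p + p} t \<partial>lborel)"
  \<comment> \<open>Reflection exchanges the closed and open ends of the interval, so the integrands
    may differ at \<open>- p\<close> and at 0, which form a null set.\<close>
  proof (rule nn_integral_cong_AE)
    show "AE t in lborel. f (- (0 + (-1) * t)) * indicator {0..<p} (0 + (-1) * t) =
        f t * indicator {- p..<- p + p} t"
      using AE_lborel_singleton[of "- p"] AE_lborel_singleton[of 0]
      by eventually_elim (auto split: split_indicator)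
  qed
  also have "\<dots> = (\<integral>\<^sup>+t. f t * indicator {0..<p} t \<partial>lborel)"
    using assms by (intro nn_integral_period)
  finally show ?thesis .
qed

section \<open>Maps of the circle that preserve the uniform measure\<close>

lemma measurable_cis_circle: "cis \<in> borel \<rightarrow>\<^sub>M circle_uniform"
proof -
  have "cis \<in> borel_measurable borel"
    by (intro borel_measurable_continuous_onI continuous_intros)
  then have "cis \<in> borel \<rightarrow>\<^sub>M restrict_space borel (sphere 0 1)"
    by (intro measurable_restrict_space2) auto
  then show ?thesis
    by (simp add: measurable_cong_sets[OF refl sets_circle_uniform])
qed

lemma measurable_into_circle:
  assumes "f \<in> borel_measurable M" "\<And>x. x \<in> space M \<Longrightarrow> norm (f x) = 1"
  shows "f \<in> M \<rightarrow>\<^sub>M circle_uniform"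
  using assms by (subst measurable_cong_sets[OF refl sets_circle_uniform])
    (auto intro!: measurable_restrict_space2)

lemma measurable_circle_id [measurable]: "(\<lambda>z. z) \<in> borel_measurable circle_uniform"
  by (subst measurable_cong_sets[OF sets_circle_uniform refl]) (intro measurable_restrict_space1 measurable_ident_sets refl)

lemma nn_integral_circle_uniform:
  assumes "f \<in> borel_measurable circle_uniform"
  shows "(\<integral>\<^sup>+z. f z \<partial>circle_uniform) =
    (\<integral>\<^sup>+t. f (cis t) * indicator {0..<2 * pi} t \<partial>lborel) / ennreal (2 * pi)"
proof -
  have [measurable]: "(\<lambda>t. f (cis t)) \<in> borel_measurable borel"
    using assms measurable_cis_circle by (rule measurable_compose[rotated])
  have f: "f \<in> borel_measurable (restrict_space borel (sphere 0 1))"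
    using assms by (simp add: measurable_cong_sets[OF sets_circle_uniform refl])
  have c: "cis \<in> uniform_measure lborel {0..<2 * pi} \<rightarrow>\<^sub>M restrict_space borel (sphere 0 1)"
    using measurable_cis_circle by (simp add: measurable_cong_sets[OF refl sets_circle_uniform] cong: measurable_cong_sets)
  have "(\<integral>\<^sup>+z. f z \<partial>circle_uniform) = (\<integral>\<^sup>+t. f (cis t) \<partial>uniform_measure lborel {0..<2 * pi})"
    unfolding circle_uniform_def using f c by (subst nn_integral_distr) auto
  also have "\<dots> = (\<integral>\<^sup>+t. f (cis t) * indicator {0..<2 * pi} t \<partial>lborel) / ennreal (2 * pi)"
    by (subst nn_integral_uniform_measure) auto
  finally show ?thesis .
qed

lemma cis_period: "cis (t + of_int n * (2 * pi)) = cis t"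
proof -
  have "cis (of_int n * (2 * pi)) = 1"
    using cis_power_int[of "2 * pi" n] by simp
  then show ?thesis
    by (simp flip: cis_mult)
qed

text \<open>This reduces invariance under \<open>g\<close> to a statement about its lift
  \<open>h\<close> to angles. Testing on sets suffices, and the indicator of a set of the circle
  becomes a periodic function of the angle; hence \<open>eq\<close> is required for periodic
  \<open>f\<close> only.\<close>

lemma distr_circle_eqI:
  assumes g: "g \<in> circle_uniform \<rightarrow>\<^sub>M circle_uniform"
    and eq: "\<And>f. \<lbrakk>f \<in> borel_measurable borel; \<And>t (n::int). f (t + of_int n * (2 * pi)) = f t\<rbrakk> \<Longrightarrow>
      (\<integral>\<^sup>+t. f (h t) * indicator {0..<2 * pi} t \<partial>lborel) =
      (\<integral>\<^sup>+t. (f t::ennreal) * indicator {0..<2 * pi} t \<partial>lborel)"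
    and h: "\<And>t. g (cis t) = cis (h t)"
  shows "distr circle_uniform circle_uniform g = circle_uniform"
proof (rule measure_eqI)
  fix A assume "A \<in> sets (distr circle_uniform circle_uniform g)"
  then have A[measurable]: "A \<in> sets circle_uniform" by simp
  let ?f = "\<lambda>t. indicator A (cis t) :: ennreal"
  have f: "?f \<in> borel_measurable borel"
    by (rule measurable_compose[OF measurable_cis_circle]) measurable
  have "emeasure (distr circle_uniform circle_uniform g) A =
      (\<integral>\<^sup>+z. indicator A (g z) \<partial>circle_uniform)"
    using nn_integral_distr[OF g, of "indicator A"] A by simp
  also have "\<dots> = (\<integral>\<^sup>+t. ?f (h t) * indicator {0..<2 * pi} t \<partial>lborel) / ennreal (2 * pi)"
    using g by (subst nn_integral_circle_uniform) (auto simp: h)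
  also have "\<dots> = (\<integral>\<^sup>+t. ?f t * indicator {0..<2 * pi} t \<partial>lborel) / ennreal (2 * pi)"
    using f by (subst eq) (simp_all add: cis_period)
  also have "\<dots> = (\<integral>\<^sup>+z. indicator A z \<partial>circle_uniform)"
    by (subst nn_integral_circle_uniform) auto
  finally show "emeasure (distr circle_uniform circle_uniform g) A = emeasure circle_uniform A"
    by simp
qed simp

lemma circle_measurable_maps:
  shows circle_rotate_measurable: "norm a = 1 \<Longrightarrow> (\<lambda>z. z * a) \<in> circle_uniform \<rightarrow>\<^sub>M circle_uniform"
    and circle_square_measurable: "(\<lambda>z. z\<^sup>2) \<in> circle_uniform \<rightarrow>\<^sub>M circle_uniform"
    and circle_cnj_measurable: "cnj \<in> circle_uniform \<rightarrow>\<^sub>M circle_uniform"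
proof -
  have "cnj \<in> borel_measurable borel"
    by (intro borel_measurable_continuous_onI continuous_intros)
  from measurable_compose[OF measurable_circle_id this]
  show "cnj \<in> circle_uniform \<rightarrow>\<^sub>M circle_uniform"
    by (rule measurable_into_circle) simp
qed (rule measurable_into_circle; simp add: norm_mult norm_power)+

lemma distr_circle_rotate:
  assumes "norm a = 1"
  shows "distr circle_uniform circle_uniform (\<lambda>z. z * a) = circle_uniform"
proof -
  obtain s where a: "a = cis s"
    using assms by (metis cis_Arg norm_zero sgn_eq zero_neq_one div_by_1 of_real_1)
  show ?thesis
  proof (rule distr_circle_eqI[where h = "\<lambda>t. t + s"])
    fix f :: "real \<Rightarrow> ennreal"
    assume f[measurable]: "f \<in> borel_measurable borel"
      and per: "\<And>t (n::int). f (t + of_int n * (2 * pi)) = f t"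
    have "(\<integral>\<^sup>+t. f (t + s) * indicator {0..<2 * pi} t \<partial>lborel) =
        (\<integral>\<^sup>+t. f t * indicator {s..<s + 2 * pi} t \<partial>lborel)"
      by (subst (2) nn_integral_real_affine[where c = 1 and t = s])
        (auto intro!: nn_integral_cong simp: add.commute split: split_indicator)
    also have "\<dots> = (\<integral>\<^sup>+t. f t * indicator {0..<2 * pi} t \<partial>lborel)"
      using per by (intro nn_integral_period) auto
    finally show "(\<integral>\<^sup>+t. f (t + s) * indicator {0..<2 * pi} t \<partial>lborel) =
      (\<integral>\<^sup>+t. f t * indicator {0..<2 * pi} t \<partial>lborel)" .
  qed (use assms in \<open>auto simp: a cis_mult intro: circle_rotate_measurable\<close>)
qed

lemma distr_circle_square: "distr circle_uniform circle_uniform (\<lambda>z. z\<^sup>2) = circle_uniform"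
  by (rule distr_circle_eqI[where h = "\<lambda>t. 2 * t"])
    (auto intro: circle_square_measurable nn_integral_period_double simp: Complex.DeMoivre)

lemma distr_circle_cnj: "distr circle_uniform circle_uniform cnj = circle_uniform"
  by (rule distr_circle_eqI[where h = uminus])
    (auto intro: circle_cnj_measurable nn_integral_period_reflect simp: cis_cnj)

section \<open>Changes of variables for spin configurations\<close>

text \<open>A finite product measure is determined by its values on boxes, and the preimage of a box
  under a componentwise map is again a box, whose sides have unchanged measure by
  \<open>eq\<close>.\<close>

lemma distr_PiM_component_maps:
  assumes "finite I" and M: "\<And>i. prob_space (M i)"
    and g: "\<And>i. i \<in> I \<Longrightarrow> g i \<in> M i \<rightarrow>\<^sub>M M i"
    and eq: "\<And>i. i \<in> I \<Longrightarrow> distr (M i) (M i) (g i) = M i"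
  shows "distr (Pi\<^sub>M I M) (Pi\<^sub>M I M) (\<lambda>\<omega>. \<lambda>i\<in>I. g i (\<omega> i)) = Pi\<^sub>M I M"
proof -
  interpret product_prob_space M
    by (rule product_prob_spaceI[OF M])
  have G: "(\<lambda>\<omega>. \<lambda>i\<in>I. g i (\<omega> i)) \<in> Pi\<^sub>M I M \<rightarrow>\<^sub>M Pi\<^sub>M I M"
    by (rule measurable_restrict) (auto intro: measurable_compose[OF measurable_component_singleton] g)
  show ?thesis
  proof (rule PiM_eqI[OF \<open>finite I\<close>])
    fix A assume A: "\<And>i. i \<in> I \<Longrightarrow> A i \<in> sets (M i)"
    have vim: "g i -` A i \<inter> space (M i) \<in> sets (M i)" if "i \<in> I" for i
      using g[OF that] A[OF that] by (rule measurable_sets)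
    have "emeasure (distr (Pi\<^sub>M I M) (Pi\<^sub>M I M) (\<lambda>\<omega>. \<lambda>i\<in>I. g i (\<omega> i))) (Pi\<^sub>E I A) =
        emeasure (Pi\<^sub>M I M) ((\<lambda>\<omega>. \<lambda>i\<in>I. g i (\<omega> i)) -` Pi\<^sub>E I A \<inter> space (Pi\<^sub>M I M))"
      using A \<open>finite I\<close> by (intro emeasure_distr G sets_PiM_I_finite)
    also have "(\<lambda>\<omega>. \<lambda>i\<in>I. g i (\<omega> i)) -` Pi\<^sub>E I A \<inter> space (Pi\<^sub>M I M) =
        (\<Pi>\<^sub>E i\<in>I. g i -` A i \<inter> space (M i))"
      by (auto simp: space_PiM PiE_iff)
    also have "emeasure (Pi\<^sub>M I M) \<dots> = (\<Prod>i\<in>I. emeasure (M i) (g i -` A i \<inter> space (M i)))"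
      using vim \<open>finite I\<close> by (intro emeasure_PiM)
    also have "\<dots> = (\<Prod>i\<in>I. emeasure (M i) (A i))"
      by (intro prod.cong refl) (metis emeasure_distr g A eq)
    finally show "emeasure (distr (Pi\<^sub>M I M) (Pi\<^sub>M I M) (\<lambda>\<omega>. \<lambda>i\<in>I. g i (\<omega> i))) (Pi\<^sub>E I A) =
        (\<Prod>i\<in>I. emeasure (M i) (A i))" .
  qed simp
qed

lemma measurable_into_spin:
  assumes "\<And>x. x \<in> V \<Longrightarrow> (\<lambda>p. h p x) \<in> borel_measurable N"
    and "\<And>x p. x \<in> V \<Longrightarrow> p \<in> space N \<Longrightarrow> norm (h p x) = 1"
  shows "(\<lambda>p. \<lambda>x\<in>V. h p x) \<in> N \<rightarrow>\<^sub>M spin_uniform V"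
  unfolding spin_uniform_def
  by (intro measurable_restrict measurable_into_circle assms)

lemma norm_spin: "\<sigma> \<in> space (spin_uniform V) \<Longrightarrow> x \<in> V \<Longrightarrow> norm (\<sigma> x) = 1"
  by (auto simp: space_spin_uniform PiE_iff)

lemma restrict_spin: "\<sigma> \<in> space (spin_uniform V) \<Longrightarrow> (\<lambda>x\<in>V. \<sigma> x) = \<sigma>"
  by (simp add: space_spin_uniform PiE_restrict)

lemma integral_spin_componentwise:
  fixes f :: "('v \<Rightarrow> complex) \<Rightarrow> real"
  assumes "finite V" and f: "f \<in> borel_measurable (spin_uniform V)"
    and g: "\<And>x. x \<in> V \<Longrightarrow> g x \<in> circle_uniform \<rightarrow>\<^sub>M circle_uniform"
    and inv: "\<And>x. x \<in> V \<Longrightarrow> distr circle_uniform circle_uniform (g x) = circle_uniform"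
  shows "(\<integral>\<sigma>. f (\<lambda>x\<in>V. g x (\<sigma> x)) \<partial>spin_uniform V) = (\<integral>\<sigma>. f \<sigma> \<partial>spin_uniform V)"
proof -
  have m: "(\<lambda>\<sigma>. \<lambda>x\<in>V. g x (\<sigma> x)) \<in> spin_uniform V \<rightarrow>\<^sub>M spin_uniform V"
    unfolding spin_uniform_def
    by (rule measurable_restrict) (auto intro: measurable_compose[OF measurable_component_singleton] g)
  have "(\<integral>\<sigma>. f \<sigma> \<partial>spin_uniform V) =
      (\<integral>\<sigma>. f \<sigma> \<partial>distr (spin_uniform V) (spin_uniform V) (\<lambda>\<sigma>. \<lambda>x\<in>V. g x (\<sigma> x)))"
    unfolding spin_uniform_def
    by (subst distr_PiM_component_maps[OF \<open>finite V\<close> prob_space_circle_uniform g inv]) auto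
  also have "\<dots> = (\<integral>\<sigma>. f (\<lambda>x\<in>V. g x (\<sigma> x)) \<partial>spin_uniform V)"
    using m f by (rule integral_distr)
  finally show ?thesis ..
qed

lemma integral_spin_rotate:
  fixes f :: "('v \<Rightarrow> complex) \<Rightarrow> real"
  assumes "finite V" "f \<in> borel_measurable (spin_uniform V)" "\<And>x. x \<in> V \<Longrightarrow> norm (a x) = 1"
  shows "(\<integral>\<sigma>. f (\<lambda>x\<in>V. \<sigma> x * a x) \<partial>spin_uniform V) = (\<integral>\<sigma>. f \<sigma> \<partial>spin_uniform V)"
  using assms
  by (intro integral_spin_componentwise[where g = "\<lambda>x z. z * a x"] distr_circle_rotate circle_rotate_measurable)

lemma integral_spin_cnj:
  fixes f :: "('v \<Rightarrow> complex) \<Rightarrow> real"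
  assumes "finite V" "f \<in> borel_measurable (spin_uniform V)"
  shows "(\<integral>\<sigma>. f (\<lambda>x\<in>V. cnj (\<sigma> x)) \<partial>spin_uniform V) = (\<integral>\<sigma>. f \<sigma> \<partial>spin_uniform V)"
  using assms
  by (intro integral_spin_componentwise[where g = "\<lambda>x. cnj"] distr_circle_cnj circle_cnj_measurable)

lemma integral_spin_square_rotate:
  fixes f :: "('v \<Rightarrow> complex) \<Rightarrow> real"
  assumes "finite V" and f: "f \<in> borel_measurable (spin_uniform V)"
    and a: "\<And>x. x \<in> V \<Longrightarrow> norm (a x) = 1"
  shows "(\<integral>\<sigma>. f (\<lambda>x\<in>V. (\<sigma> x)\<^sup>2 * a x) \<partial>spin_uniform V) = (\<integral>\<sigma>. f \<sigma> \<partial>spin_uniform V)"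
proof -
  have m: "(\<lambda>\<sigma>. \<lambda>x\<in>V. \<sigma> x * a x) \<in> spin_uniform V \<rightarrow>\<^sub>M spin_uniform V"
    using a by (intro measurable_into_spin)
      (auto simp: norm_mult norm_spin intro!: borel_measurable_times measurable_spin)
  \<comment> \<open>The squaring is removed first, with the rotated function as the observable; the
    rotation is then removed from \<open>f\<close> itself.\<close>
  have "(\<integral>\<sigma>. f (\<lambda>x\<in>V. (\<lambda>x\<in>V. (\<sigma> x)\<^sup>2) x * a x) \<partial>spin_uniform V) =
      (\<integral>\<sigma>. f (\<lambda>x\<in>V. \<sigma> x * a x) \<partial>spin_uniform V)"
    using measurable_compose[OF m f]
    by (intro integral_spin_componentwise[where f = "\<lambda>\<sigma>. f (\<lambda>x\<in>V. \<sigma> x * a x)" and g = "\<lambda>x z. z\<^sup>2"]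
        assms distr_circle_square circle_square_measurable)
  also have "\<dots> = (\<integral>\<sigma>. f \<sigma> \<partial>spin_uniform V)"
    using assms by (rule integral_spin_rotate)
  finally show ?thesis
    by (simp cong: restrict_cong)
qed

text \<open>In angles, this is the substitution \<open>(\<alpha>, \<beta>) \<mapsto> (\<alpha> + \<beta>, \<alpha> - \<beta>)\<close>. It is two-to-one in each component
  but still preserves Haar measure: first rotate \<open>\<alpha>\<close> by \<open>\<beta>\<close>, which gives \<open>(\<alpha> + 2 \<beta>, \<alpha>)\<close>, then use
  that doubling and rotating \<open>\<beta>\<close> preserves the uniform measure.\<close>

lemma integral_spin_sum_difference:
  fixes F :: "('v \<Rightarrow> complex) \<Rightarrow> ('v \<Rightarrow> complex) \<Rightarrow> real"
  assumes V: "finite V"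
    and F: "case_prod F \<in> borel_measurable (spin_uniform V \<Otimes>\<^sub>M spin_uniform V)"
    and bound: "\<And>\<sigma> \<tau>. \<lbrakk>\<sigma> \<in> space (spin_uniform V); \<tau> \<in> space (spin_uniform V)\<rbrakk> \<Longrightarrow> \<bar>F \<sigma> \<tau>\<bar> \<le> B"
  shows "(\<integral>\<sigma>. \<integral>\<tau>. F (\<lambda>x\<in>V. \<sigma> x * \<tau> x) (\<lambda>x\<in>V. \<sigma> x * cnj (\<tau> x)) \<partial>spin_uniform V \<partial>spin_uniform V) =
    (\<integral>\<sigma>. \<integral>\<tau>. F \<sigma> \<tau> \<partial>spin_uniform V \<partial>spin_uniform V)"
proof -
  let ?M = "spin_uniform V"
  let ?m = "\<lambda>\<sigma> \<tau>. \<lambda>x\<in>V. \<sigma> x * \<tau> x" and ?d = "\<lambda>\<sigma> \<tau>. \<lambda>x\<in>V. \<sigma> x * cnj (\<tau> x)"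
    and ?q = "\<lambda>\<sigma> \<tau>. \<lambda>x\<in>V. (\<tau> x)\<^sup>2 * \<sigma> x"
  interpret prob_space ?M by (rule prob_space_spin_uniform)
  interpret P: pair_prob_space ?M ?M ..
  note spins = measurable_compose[OF measurable_fst measurable_spin]
    measurable_compose[OF measurable_snd measurable_spin]
  have cnj: "cnj \<in> borel_measurable borel"
    by (intro borel_measurable_continuous_onI continuous_intros)
  have "(\<lambda>p. ?m (fst p) (snd p)) \<in> ?M \<Otimes>\<^sub>M ?M \<rightarrow>\<^sub>M ?M"
    by (intro measurable_into_spin borel_measurable_times spins)
      (auto simp: norm_mult norm_spin space_pair_measure)
  moreover have "(\<lambda>p. ?d (fst p) (snd p)) \<in> ?M \<Otimes>\<^sub>M ?M \<rightarrow>\<^sub>M ?M"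
    by (intro measurable_into_spin borel_measurable_times spins measurable_compose[OF _ cnj])
      (auto simp: norm_mult norm_spin space_pair_measure)
  moreover have q: "(\<lambda>p. ?q (fst p) (snd p)) \<in> ?M \<Otimes>\<^sub>M ?M \<rightarrow>\<^sub>M ?M"
    by (intro measurable_into_spin borel_measurable_times borel_measurable_power spins)
      (auto simp: norm_mult norm_power norm_spin space_pair_measure)
  ultimately have meas:
      "(\<lambda>p. F (?m (fst p) (snd p)) (?d (fst p) (snd p))) \<in> borel_measurable (?M \<Otimes>\<^sub>M ?M)"
      "(\<lambda>p. F (?q (fst p) (snd p)) (fst p)) \<in> borel_measurable (?M \<Otimes>\<^sub>M ?M)"
    using measurable_compose[OF measurable_Pair F] by auto
  have space: "?m \<sigma> \<tau> \<in> space ?M" "?d \<sigma> \<tau> \<in> space ?M" "?q \<sigma> \<tau> \<in> space ?M"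
    if "\<sigma> \<in> space ?M" "\<tau> \<in> space ?M" for \<sigma> \<tau>
    using that by (auto simp: space_spin_uniform PiE_iff norm_mult norm_power)
  \<comment> \<open>Each exchange of the order of integration below needs integrability on the
    product, which boundedness by \<open>B\<close> provides on a probability space.\<close>
  have int: "integrable (?M \<Otimes>\<^sub>M ?M) (\<lambda>(\<sigma>, \<tau>). F (?m \<sigma> \<tau>) (?d \<sigma> \<tau>))"
    "integrable (?M \<Otimes>\<^sub>M ?M) (\<lambda>(\<sigma>, \<tau>). F (?q \<sigma> \<tau>) \<sigma>)"
    "integrable (?M \<Otimes>\<^sub>M ?M) (\<lambda>(\<sigma>, \<tau>). F \<sigma> \<tau>)"
    using F meas bound space
    by (auto intro!: P.integrable_const_bound[where B = B] AE_I2 simp: space_pair_measure case_prod_beta')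
  \<comment> \<open>The integral over \<sigma> must be the inner one, because \<sigma> is rotated by
    \<tau> while \<tau> is held fixed.\<close>
  have "(\<integral>\<sigma>. \<integral>\<tau>. F (?m \<sigma> \<tau>) (?d \<sigma> \<tau>) \<partial>?M \<partial>?M) = (\<integral>\<tau>. \<integral>\<sigma>. F (?m \<sigma> \<tau>) (?d \<sigma> \<tau>) \<partial>?M \<partial>?M)"
    by (rule P.Fubini_integral[OF int(1), symmetric])
  also have "\<dots> = (\<integral>\<tau>. \<integral>\<sigma>. F (?q \<sigma> \<tau>) \<sigma> \<partial>?M \<partial>?M)"
  proof (rule Bochner_Integration.integral_cong[OF refl])
    fix \<tau> assume \<tau>: "\<tau> \<in> space ?M"
    have "(\<lambda>\<sigma>. F (?m \<sigma> \<tau>) (?d \<sigma> \<tau>)) \<in> borel_measurable ?M"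
      using measurable_compose[OF measurable_Pair2'[OF \<tau>] meas(1)] by simp
    then have "(\<integral>\<sigma>. F (?m \<sigma> \<tau>) (?d \<sigma> \<tau>) \<partial>?M) = (\<integral>\<sigma>. F (?m (?m \<sigma> \<tau>) \<tau>) (?d (?m \<sigma> \<tau>) \<tau>) \<partial>?M)"
      using V \<tau> by (intro integral_spin_rotate[symmetric]) (auto simp: norm_spin)
    also have "\<dots> = (\<integral>\<sigma>. F (?q \<sigma> \<tau>) \<sigma> \<partial>?M)"
    proof (rule Bochner_Integration.integral_cong[OF refl])
      fix \<sigma> assume \<sigma>: "\<sigma> \<in> space ?M"
      \<comment> \<open>Since \<tau> has modulus 1, multiplying by its conjugate undoes the
        rotation, and the second argument of \<open>F\<close> becomes \<sigma> alone.\<close>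
      have "\<tau> x * cnj (\<tau> x) = 1" if "x \<in> V" for x
        using norm_spin[OF \<tau> that] by (simp add: complex_norm_square[symmetric])
      then have "?d (?m \<sigma> \<tau>) \<tau> = (\<lambda>x\<in>V. \<sigma> x)"
        by (auto simp: mult.assoc)
      moreover have "?m (?m \<sigma> \<tau>) \<tau> = ?q \<sigma> \<tau>"
        by (auto simp: power2_eq_square)
      ultimately show "F (?m (?m \<sigma> \<tau>) \<tau>) (?d (?m \<sigma> \<tau>) \<tau>) = F (?q \<sigma> \<tau>) \<sigma>"
        using restrict_spin[OF \<sigma>] by (simp only:)
    qed
    finally show "(\<integral>\<sigma>. F (?m \<sigma> \<tau>) (?d \<sigma> \<tau>) \<partial>?M) = (\<integral>\<sigma>. F (?q \<sigma> \<tau>) \<sigma> \<partial>?M)" .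
  qed
  also have "\<dots> = (\<integral>\<sigma>. \<integral>\<tau>. F (?q \<sigma> \<tau>) \<sigma> \<partial>?M \<partial>?M)"
    by (rule P.Fubini_integral[OF int(2)])
  \<comment> \<open>Now \<sigma> is fixed and serves as the rotation, so the squared and rotated
    \<tau> is again uniform. The arguments of \<open>F\<close> come out exchanged, which the last
    use of Fubini repairs.\<close>
  also have "\<dots> = (\<integral>\<sigma>. \<integral>\<tau>. F \<tau> \<sigma> \<partial>?M \<partial>?M)"
  proof (rule Bochner_Integration.integral_cong[OF refl])
    fix \<sigma> assume \<sigma>: "\<sigma> \<in> space ?M"
    have "(\<lambda>\<tau>. F \<tau> \<sigma>) \<in> borel_measurable ?M"
      using measurable_compose[OF measurable_Pair2'[OF \<sigma>] F] by simp
    then show "(\<integral>\<tau>. F (?q \<sigma> \<tau>) \<sigma> \<partial>?M) = (\<integral>\<tau>. F \<tau> \<sigma> \<partial>?M)"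
      using V \<sigma> by (intro integral_spin_square_rotate) (auto simp: norm_spin)
  qed
  also have "\<dots> = (\<integral>\<sigma>. \<integral>\<tau>. F \<sigma> \<tau> \<partial>?M \<partial>?M)"
    by (rule P.Fubini_integral) (use int(3) in simp)
  finally show ?thesis .
qed

section \<open>Duplicated systems and positive kernels\<close>

lemma (in prob_space) integral_pair_product:
  fixes f g :: "'a \<Rightarrow> real"
  assumes f: "integrable M f" and g: "integrable M g"
  shows "integrable (M \<Otimes>\<^sub>M M) (\<lambda>p. f (fst p) * g (snd p))"
    and "(\<integral>p. f (fst p) * g (snd p) \<partial>(M \<Otimes>\<^sub>M M)) = (\<integral>x. f x \<partial>M) * (\<integral>x. g x \<partial>M)"
proof -
  interpret P: pair_prob_space M M ..
  have [measurable]: "f \<in> borel_measurable M" "g \<in> borel_measurable M"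
    using f g by auto
  show *: "integrable (M \<Otimes>\<^sub>M M) (\<lambda>p. f (fst p) * g (snd p))"
    using f g by (intro P.Fubini_integrable) (auto simp: abs_mult)
  show "(\<integral>p. f (fst p) * g (snd p) \<partial>(M \<Otimes>\<^sub>M M)) = (\<integral>x. f x \<partial>M) * (\<integral>x. g x \<partial>M)"
    by (subst P.integral_fst'[OF *, symmetric]) simp
qed

text \<open>Multiplying out gives four terms, each a product of a function of the first copy and one
  of the second, so each integral factorizes; they agree in pairs by symmetry. The weight is not
  normalized, hence the factor that is the integral of \<open>w\<close>.\<close>

lemma covariance_by_duplication:
  fixes w A B :: "'a \<Rightarrow> real"
  assumes "prob_space M" and "integrable M w" "integrable M (\<lambda>x. A x * w x)"
    "integrable M (\<lambda>x. B x * w x)" "integrable M (\<lambda>x. A x * B x * w x)"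
  shows "(\<integral>p. (A (fst p) - A (snd p)) * (B (fst p) - B (snd p)) * (w (fst p) * w (snd p)) \<partial>(M \<Otimes>\<^sub>M M)) =
    2 * ((\<integral>x. w x \<partial>M) * (\<integral>x. A x * B x * w x \<partial>M) - (\<integral>x. A x * w x \<partial>M) * (\<integral>x. B x * w x \<partial>M))"
proof -
  interpret prob_space M by fact
  have product: "has_bochner_integral (M \<Otimes>\<^sub>M M) (\<lambda>p. f (fst p) * g (snd p)) ((\<integral>x. f x \<partial>M) * (\<integral>x. g x \<partial>M))"
    if "integrable M f" "integrable M g" for f g :: "'a \<Rightarrow> real"
    using integral_pair_product[OF that] by (simp add: has_bochner_integral_iff)
  note expansion = has_bochner_integral_diff[OF
      has_bochner_integral_add[OF product[OF assms(5,2)] product[OF assms(2,5)]]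
      has_bochner_integral_add[OF product[OF assms(3,4)] product[OF assms(4,3)]]]
  show ?thesis
    by (rule trans[OF _ trans[OF has_bochner_integral_integral_eq[OF expansion]]])
      (simp_all add: algebra_simps)
qed

section \<open>Positivity of exponentials of positive kernels\<close>

text \<open>For nonnegative \<open>a\<close> this is a positive semidefinite kernel of finite rank.
  With \<open>a e = 2 * J e\<close> and \<open>c e\<close> the inner product along the edge, it is
  the exponent of the joint Boltzmann weight after the substitution.\<close>

definition pair_kernel :: "'e set \<Rightarrow> ('e \<Rightarrow> real) \<Rightarrow> ('e \<Rightarrow> 'a \<Rightarrow> real) \<Rightarrow> 'a \<times> 'a \<Rightarrow> real" where
  "pair_kernel E a c p = (\<Sum>e\<in>E. a e * (c e (fst p) * c e (snd p)))"

context prob_space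
begin

context
  fixes E :: "'e set" and a :: "'e \<Rightarrow> real" and c :: "'e \<Rightarrow> 'a \<Rightarrow> real"
  assumes E: "finite E" and a: "\<And>e. e \<in> E \<Longrightarrow> 0 \<le> a e"
    and c [measurable]: "\<And>e. e \<in> E \<Longrightarrow> c e \<in> borel_measurable M"
    and c_le: "\<And>e x. e \<in> E \<Longrightarrow> x \<in> space M \<Longrightarrow> \<bar>c e x\<bar> \<le> 1"
begin

lemma pair_kernel_measurable [measurable]: "pair_kernel E a c \<in> borel_measurable (M \<Otimes>\<^sub>M M)"
  unfolding pair_kernel_def[abs_def] by measurable

lemma pair_kernel_bound:
  assumes "p \<in> space (M \<Otimes>\<^sub>M M)"
  shows "\<bar>pair_kernel E a c p\<bar> \<le> sum a E"
proof -
  have "\<bar>a e * (c e (fst p) * c e (snd p))\<bar> \<le> a e" if "e \<in> E" for e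
    using assms that a c_le[OF that]
    by (auto simp: abs_mult space_pair_measure intro!: mult_left_le mult_le_one)
  then show ?thesis
    unfolding pair_kernel_def by (intro order_trans[OF sum_abs] sum_mono)
qed

text \<open>The pointwise bound later yields the majorant of the exponential series.\<close>

lemma integrable_pair_kernel_power:
  assumes [measurable]: "g \<in> borel_measurable M" and "\<And>x. x \<in> space M \<Longrightarrow> \<bar>g x\<bar> \<le> 1"
  shows "integrable (M \<Otimes>\<^sub>M M) (\<lambda>p. g (fst p) * g (snd p) * pair_kernel E a c p ^ n)"
    and "p \<in> space (M \<Otimes>\<^sub>M M) \<Longrightarrow> \<bar>g (fst p) * g (snd p) * pair_kernel E a c p ^ n\<bar> \<le> sum a E ^ n"
proof -
  interpret P: pair_prob_space M M ..
  show *: "\<bar>g (fst p) * g (snd p) * pair_kernel E a c p ^ n\<bar> \<le> sum a E ^ n"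
    if p: "p \<in> space (M \<Otimes>\<^sub>M M)" for p
  proof -
    have "\<bar>g (fst p)\<bar> * \<bar>g (snd p)\<bar> \<le> 1"
      using p assms(2) by (intro mult_le_one) (auto simp: space_pair_measure)
    moreover have "\<bar>pair_kernel E a c p\<bar> ^ n \<le> sum a E ^ n"
      using pair_kernel_bound[OF p] by (intro power_mono) auto
    ultimately have "\<bar>g (fst p)\<bar> * \<bar>g (snd p)\<bar> * \<bar>pair_kernel E a c p\<bar> ^ n \<le> 1 * sum a E ^ n"
      by (intro mult_mono) auto
    then show ?thesis
      by (simp add: abs_mult power_abs)
  qed
  show "integrable (M \<Otimes>\<^sub>M M) (\<lambda>p. g (fst p) * g (snd p) * pair_kernel E a c p ^ n)"
    using * by (intro P.integrable_const_bound[where B = "sum a E ^ n"] AE_I2) auto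
qed

text \<open>Induction on \<open>n\<close> for all \<open>g\<close> at once: peeling off one kernel
  factor gives a nonnegative combination of integrals of the same form with \<open>g\<close>
  replaced by \<open>g * c e\<close>, still bounded by 1. For \<open>n = 0\<close> the integral is
  the square of the integral of \<open>g\<close>.\<close>

lemma integral_pair_kernel_power_nonneg:
  assumes "g \<in> borel_measurable M" "\<And>x. x \<in> space M \<Longrightarrow> \<bar>g x\<bar> \<le> 1"
  shows "0 \<le> (\<integral>p. g (fst p) * g (snd p) * pair_kernel E a c p ^ n \<partial>(M \<Otimes>\<^sub>M M))"
  using assms
proof (induction n arbitrary: g)
  case 0
  then have "integrable M g"
    by (intro integrable_const_bound[where B = 1] AE_I2) auto
  then show ?case
    by (simp add: integral_pair_product)
next
  case (Suc n)
  have ge: "(\<lambda>x. g x * c e x) \<in> borel_measurable M"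
    "\<And>x. x \<in> space M \<Longrightarrow> \<bar>g x * c e x\<bar> \<le> 1" if "e \<in> E" for e
    using Suc.prems that c_le c by (auto simp: abs_mult intro!: mult_le_one)
  have "(\<integral>p. g (fst p) * g (snd p) * pair_kernel E a c p ^ Suc n \<partial>(M \<Otimes>\<^sub>M M)) =
      (\<integral>p. (\<Sum>e\<in>E. a e * ((g (fst p) * c e (fst p)) * (g (snd p) * c e (snd p)) * pair_kernel E a c p ^ n))
        \<partial>(M \<Otimes>\<^sub>M M))"
    unfolding power_Suc
    by (subst (1) pair_kernel_def) (simp add: sum_distrib_left sum_distrib_right mult_ac)
  also have "\<dots> = (\<Sum>e\<in>E. a e * (\<integral>p. (g (fst p) * c e (fst p)) * (g (snd p) * c e (snd p)) *
      pair_kernel E a c p ^ n \<partial>(M \<Otimes>\<^sub>M M)))"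
    by (subst Bochner_Integration.integral_sum)
      (use ge in \<open>auto intro!: integrable_mult_right integrable_pair_kernel_power(1)\<close>)
  also have "\<dots> \<ge> 0"
    using Suc.IH[OF ge] a by (intro sum_nonneg mult_nonneg_nonneg) auto
  finally show ?case .
qed

lemma integrable_exp_pair_kernel:
  assumes [measurable]: "g \<in> borel_measurable M" and "\<And>x. x \<in> space M \<Longrightarrow> \<bar>g x\<bar> \<le> 1"
  shows "integrable (M \<Otimes>\<^sub>M M) (\<lambda>p. g (fst p) * g (snd p) * exp (pair_kernel E a c p))"
proof -
  interpret P: pair_prob_space M M ..
  have "\<bar>g (fst p)\<bar> * \<bar>g (snd p)\<bar> * exp (pair_kernel E a c p) \<le> 1 * exp (sum a E)"
    if p: "p \<in> space (M \<Otimes>\<^sub>M M)" for p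
    using p assms(2) pair_kernel_bound[OF p]
    by (intro mult_mono mult_le_one) (auto simp: space_pair_measure)
  then show ?thesis
    by (intro P.integrable_const_bound[where B = "1 * exp (sum a E)"] AE_I2) (auto simp: abs_mult)
qed

text \<open>The exponential series is integrated term by term, and each term is nonnegative by the
  previous result on powers. The exchange is justified by the convergent series of
  \<open>sum a E ^ n / fact n\<close>, which dominates the terms pointwise and, as the total mass is
  1, also their integrals.\<close>

lemma integral_exp_pair_kernel_nonneg:
  assumes g: "g \<in> borel_measurable M" "\<And>x. x \<in> space M \<Longrightarrow> \<bar>g x\<bar> \<le> 1"
  shows "0 \<le> (\<integral>p. g (fst p) * g (snd p) * exp (pair_kernel E a c p) \<partial>(M \<Otimes>\<^sub>M M))"
proof -
  interpret P: pair_prob_space M M ..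
  let ?h = "\<lambda>n p. g (fst p) * g (snd p) * pair_kernel E a c p ^ n"
  let ?f = "\<lambda>n p. ?h n p / fact n"
  have sums: "(\<lambda>n. ?f n p) sums (g (fst p) * g (snd p) * exp (pair_kernel E a c p))" for p
    using sums_mult[OF exp_converges[of "pair_kernel E a c p"], of "g (fst p) * g (snd p)"]
    by (simp add: field_simps)
  have int: "integrable (M \<Otimes>\<^sub>M M) (?f n)" for n
    using integrable_pair_kernel_power(1)[OF g] by simp
  have le: "norm (?f n p) \<le> sum a E ^ n / fact n" if "p \<in> space (M \<Otimes>\<^sub>M M)" for n p
    using integrable_pair_kernel_power(2)[OF g that, of n]
    by (simp add: divide_right_mono)
  have summable: "summable (\<lambda>n. sum a E ^ n / fact n)"
    using summable_exp[of "sum a E"] by (simp only: divide_inverse mult.commute[of "inverse _"])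
  have f_sums: "(\<lambda>n. \<integral>p. ?f n p \<partial>(M \<Otimes>\<^sub>M M)) sums (\<integral>p. (\<Sum>n. ?f n p) \<partial>(M \<Otimes>\<^sub>M M))"
  proof (rule sums_integral[OF int])
    show "AE p in M \<Otimes>\<^sub>M M. summable (\<lambda>n. norm (?f n p))"
    proof (rule AE_I2)
      fix p assume p: "p \<in> space (M \<Otimes>\<^sub>M M)"
      show "summable (\<lambda>n. norm (?f n p))"
        by (rule summable_comparison_test'[OF summable, where N = 0]) (simp only: real_norm_def abs_idempotent le[OF p, unfolded real_norm_def])
    qed
    have "(\<integral>p. norm (?f n p) \<partial>(M \<Otimes>\<^sub>M M)) \<le> sum a E ^ n / fact n" for n
      by (rule P.integral_le_const[OF integrable_norm[OF int] AE_I2[OF le]])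
    then show "summable (\<lambda>n. \<integral>p. norm (?f n p) \<partial>(M \<Otimes>\<^sub>M M))"
      by (intro summable_comparison_test'[OF summable, where N = 0])
        (simp only: real_norm_def abs_of_nonneg integral_nonneg_AE norm_ge_zero AE_I2)
  qed
  have f_nonneg: "0 \<le> (\<integral>p. ?f n p \<partial>(M \<Otimes>\<^sub>M M))" for n
    using integral_pair_kernel_power_nonneg[OF g] by simp
  have "0 \<le> (\<integral>p. (\<Sum>n. ?f n p) \<partial>(M \<Otimes>\<^sub>M M))"
    by (rule sums_le[OF f_nonneg sums_zero f_sums])
  then show ?thesis
    using sums_unique[OF sums] by simp
qed

end

end

section \<open>Spin observables and the XY model\<close>

lemma spin_monomial_times:
  "spin_monomial V \<phi> (\<lambda>x\<in>V. \<sigma> x * \<tau> x) = spin_monomial V \<phi> \<sigma> * spin_monomial V \<phi> \<tau>"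
  unfolding spin_monomial_def by (simp add: power_int_mult_distrib prod.distrib cong: prod.cong)

lemma spin_monomial_cnj:
  "spin_monomial V \<phi> (\<lambda>x\<in>V. cnj (\<sigma> x)) = cnj (spin_monomial V \<phi> \<sigma>)"
  unfolding spin_monomial_def by (simp cong: prod.cong)

lemma spin_monomial_times_cnj:
  "spin_monomial V \<phi> (\<lambda>x\<in>V. \<sigma> x * cnj (\<tau> x)) = spin_monomial V \<phi> \<sigma> * cnj (spin_monomial V \<phi> \<tau>)"
  unfolding spin_monomial_def by (simp add: power_int_mult_distrib prod.distrib cong: prod.cong)

lemma norm_spin_monomial:
  "\<sigma> \<in> space (spin_uniform V) \<Longrightarrow> norm (spin_monomial V \<phi> \<sigma>) = 1"
  unfolding spin_monomial_def prod_norm[symmetric] by (simp add: norm_power_int norm_spin)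

lemma spin_monomial_add:
  assumes "\<sigma> \<in> space (spin_uniform V)"
  shows "spin_monomial V (\<lambda>v. \<phi> v + \<psi> v) \<sigma> = spin_monomial V \<phi> \<sigma> * spin_monomial V \<psi> \<sigma>"
proof -
  have "\<sigma> x \<noteq> 0" if "x \<in> V" for x
    using norm_spin[OF assms that] by auto
  then show ?thesis
    unfolding spin_monomial_def by (simp add: power_int_add prod.distrib cong: prod.cong)
qed

text \<open>On the unit circle the conjugate is the inverse, so subtracting an exponent is
  multiplying by a conjugate.\<close>

lemma spin_monomial_diff:
  assumes "\<sigma> \<in> space (spin_uniform V)"
  shows "spin_monomial V (\<lambda>v. \<phi> v - \<psi> v) \<sigma> = spin_monomial V \<phi> \<sigma> * cnj (spin_monomial V \<psi> \<sigma>)"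
proof -
  have nz: "\<sigma> x \<noteq> 0" and cnj: "cnj (\<sigma> x) = inverse (\<sigma> x)" if "x \<in> V" for x
  proof -
    have "\<sigma> x * cnj (\<sigma> x) = 1"
      using norm_spin[OF assms that] by (simp add: complex_norm_square[symmetric])
    then show "\<sigma> x \<noteq> 0" "cnj (\<sigma> x) = inverse (\<sigma> x)"
      by (auto simp: inverse_unique)
  qed
  have "\<sigma> x powi (\<phi> x - \<psi> x) = \<sigma> x powi \<phi> x * cnj (\<sigma> x) powi \<psi> x" if "x \<in> V" for x
    using nz[OF that] by (simp add: cnj[OF that] power_int_diff power_int_inverse divide_inverse)
  then show ?thesis
    unfolding spin_monomial_def by (simp add: prod.distrib cong: prod.cong)
qed

lemma spin_monomial_measurable [measurable]:
  "spin_monomial V \<phi> \<in> borel_measurable (spin_uniform V)"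
proof -
  have "(\<lambda>\<sigma>. \<sigma> x powi \<phi> x) \<in> borel_measurable (spin_uniform V)" if "x \<in> V" for x
    unfolding power_int_def using measurable_spin[OF that] by (cases "0 \<le> \<phi> x") auto
  then show ?thesis
    unfolding spin_monomial_def[abs_def] by (rule borel_measurable_prod)
qed

lemma cos_angle_pairing:
  assumes "\<sigma> \<in> space (spin_uniform V)"
  shows "cos (angle_pairing V \<phi> \<sigma>) = Re (spin_monomial V \<phi> \<sigma>)"
proof (cases "finite V")
  case True
  have "\<sigma> x = cis (Arg2pi (\<sigma> x))" if "x \<in> V" for x
    using Arg2pi_eq[of "\<sigma> x"] norm_spin[OF assms that] by (simp add: cis_conv_exp)
  then have "\<sigma> x powi \<phi> x = cis (of_int (\<phi> x) * Arg2pi (\<sigma> x))" if "x \<in> V" for x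
    using that by (metis cis_power_int)
  then have "spin_monomial V \<phi> \<sigma> = (\<Prod>x\<in>V. cis (of_int (\<phi> x) * Arg2pi (\<sigma> x)))"
    unfolding spin_monomial_def by (rule prod.cong[OF refl])
  also have "\<dots> = cis (angle_pairing V \<phi> \<sigma>)"
    unfolding angle_pairing_def using True by (simp add: cis_conv_exp sum_distrib_left exp_sum)
  finally show ?thesis by simp
\<comment> \<open>For infinite \<open>V\<close> the sum is 0 and the product is 1 by convention, and
  both sides equal 1.\<close>
qed (simp add: angle_pairing_def spin_monomial_def)

text \<open>Let u be \<sigma> at one end times the conjugate of \<sigma> at the other, and v the
  same for \<tau>. The identity is Re (u v) + Re (u \<open>cnj\<close> v) = 2 Re u Re v, on the
  circle the formula for cos (a + b) + cos (a - b).\<close>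

lemma edge_inner_times_add_times_cnj:
  assumes "finite_graph V E" "e \<in> E"
  shows "edge_inner (\<lambda>x\<in>V. \<sigma> x * \<tau> x) e + edge_inner (\<lambda>x\<in>V. \<sigma> x * cnj (\<tau> x)) e =
    2 * (edge_inner \<sigma> e * edge_inner \<tau> e)"
proof -
  obtain x y where "e = {x, y}" "x \<in> V" "y \<in> V"
    using assms by (rule finite_graph_edgeE)
  then show ?thesis
    by (simp add: edge_inner_doubleton inner_complex_def algebra_simps)
qed

lemma edge_inner_cnj:
  assumes "finite_graph V E" "e \<in> E"
  shows "edge_inner (\<lambda>x\<in>V. cnj (\<sigma> x)) e = edge_inner \<sigma> e"
proof -
  obtain x y where "e = {x, y}" "x \<in> V" "y \<in> V"
    using assms by (rule finite_graph_edgeE)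
  then show ?thesis
    by (simp add: edge_inner_doubleton inner_complex_def)
qed

lemma edge_inner_measurable:
  assumes "finite_graph V E" "e \<in> E"
  shows "(\<lambda>\<sigma>. edge_inner \<sigma> e) \<in> borel_measurable (spin_uniform V)"
proof -
  obtain x y where e: "e = {x, y}" and "x \<in> V" "y \<in> V"
    using assms by (rule finite_graph_edgeE)
  then show ?thesis
    unfolding e edge_inner_doubleton by (intro borel_measurable_inner measurable_spin)
qed

lemma abs_edge_inner_le_1:
  assumes "finite_graph V E" "e \<in> E" "\<sigma> \<in> space (spin_uniform V)"
  shows "\<bar>edge_inner \<sigma> e\<bar> \<le> 1"
proof -
  obtain x y where e: "e = {x, y}" "x \<in> V" "y \<in> V"
    using assms(1,2) by (rule finite_graph_edgeE)
  then show ?thesis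
    using Cauchy_Schwarz_ineq2[of "\<sigma> x" "\<sigma> y"] norm_spin[OF assms(3)]
    by (simp add: edge_inner_doubleton)
qed

lemma finite_graph_finite_edges: "finite_graph V E \<Longrightarrow> finite E"
  by (rule finite_subset[of _ "Pow V"]) (auto simp: finite_graph_def)

section \<open>Gibbs expectations as weighted integrals\<close>

lemma xy_expectation_eq:
  fixes f :: "('v \<Rightarrow> complex) \<Rightarrow> 'b::{banach, second_countable_topology}"
  assumes "finite_graph V E" "f \<in> borel_measurable (spin_uniform V)"
  shows "xy_expectation V E J f =
    (\<integral>\<sigma>. exp (- xy_hamiltonian E J \<sigma>) *\<^sub>R f \<sigma> \<partial>spin_uniform V) /\<^sub>R xy_partition V E J"
proof -
  note [measurable] = xy_hamiltonian_measurable[OF assms(1), of J] assms(2)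
  have "xy_expectation V E J f =
      (\<integral>\<sigma>. (exp (- xy_hamiltonian E J \<sigma>) / xy_partition V E J) *\<^sub>R f \<sigma> \<partial>spin_uniform V)"
    unfolding xy_expectation_def xy_gibbs_def
    using xy_partition_pos[OF assms(1), of J] by (intro integral_density) auto
  also have "\<dots> = (\<integral>\<sigma>. inverse (xy_partition V E J) *\<^sub>R (exp (- xy_hamiltonian E J \<sigma>) *\<^sub>R f \<sigma>) \<partial>spin_uniform V)"
    by (simp add: divide_inverse mult.commute)
  finally show ?thesis
    by (simp only: integral_scaleR_right)
qed

lemma space_xy_gibbs: "space (xy_gibbs V E J) = space (spin_uniform V)"
  by (simp add: xy_gibbs_def)

lemma xy_expectation_cong:
  assumes "\<And>\<sigma>. \<sigma> \<in> space (spin_uniform V) \<Longrightarrow> f \<sigma> = g \<sigma>"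
  shows "xy_expectation V E J f = xy_expectation V E J g"
  unfolding xy_expectation_def
  by (intro Bochner_Integration.integral_cong refl) (simp add: assms space_xy_gibbs)

lemma integrable_xy_gibbs:
  fixes f :: "('v \<Rightarrow> complex) \<Rightarrow> 'b::{banach, second_countable_topology}"
  assumes "finite_graph V E" "f \<in> borel_measurable (spin_uniform V)"
    and "\<And>\<sigma>. \<sigma> \<in> space (spin_uniform V) \<Longrightarrow> norm (f \<sigma>) \<le> B"
  shows "integrable (xy_gibbs V E J) f"
proof -
  interpret prob_space "xy_gibbs V E J" by (rule prob_space_xy_gibbs[OF assms(1)])
  show ?thesis
    using assms(2,3) by (intro integrable_const_bound[where B = B] AE_I2)
      (auto simp: space_xy_gibbs, simp add: xy_gibbs_def)
qed

text \<open>Conjugating all spins preserves both the uniform measure and the energy but changes the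
  sign of the imaginary part, so its integral equals its own negative.\<close>

lemma Im_xy_expectation_spin_monomial:
  assumes "finite_graph V E"
  shows "Im (xy_expectation V E J (spin_monomial V \<phi>)) = 0"
proof -
  let ?M = "spin_uniform V" and ?w = "\<lambda>\<sigma>. exp (- xy_hamiltonian E J \<sigma>)"
  note [measurable] = xy_hamiltonian_measurable[OF assms, of J]
  let ?f = "\<lambda>\<sigma>. ?w \<sigma> * Im (spin_monomial V \<phi> \<sigma>)"
  have "finite V"
    using assms by (simp add: finite_graph_def)
  then have "(\<integral>\<sigma>. ?f (\<lambda>x\<in>V. cnj (\<sigma> x)) \<partial>?M) = (\<integral>\<sigma>. ?f \<sigma> \<partial>?M)"
    by (rule integral_spin_cnj) measurable
  moreover have "xy_hamiltonian E J (\<lambda>x\<in>V. cnj (\<sigma> x)) = xy_hamiltonian E J \<sigma>" for \<sigma>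
    unfolding xy_hamiltonian_def using edge_inner_cnj[OF assms] by simp
  ultimately have 0: "(\<integral>\<sigma>. ?f \<sigma> \<partial>?M) = 0"
    by (simp add: spin_monomial_cnj)
  have "Im (xy_expectation V E J (spin_monomial V \<phi>)) =
      xy_expectation V E J (\<lambda>\<sigma>. Im (spin_monomial V \<phi> \<sigma>))"
    unfolding xy_expectation_def
    using norm_spin_monomial[of _ V \<phi>]
    by (intro integral_Im[symmetric] integrable_xy_gibbs[OF assms, where B = 1]) auto
  also have "\<dots> = 0"
    using 0 by (subst xy_expectation_eq[OF assms]) auto
  finally show ?thesis .
qed

lemma Re_xy_expectation_spin_monomial:
  assumes "finite_graph V E"
  shows "Re (xy_expectation V E J (spin_monomial V \<phi>)) =
    xy_expectation V E J (\<lambda>\<sigma>. Re (spin_monomial V \<phi> \<sigma>))"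
  unfolding xy_expectation_def
  using norm_spin_monomial[of _ V \<phi>]
  by (intro integral_Re[symmetric] integrable_xy_gibbs[OF assms, where B = 1]) auto

section \<open>The Ginibre inequality\<close>

lemma ginibre_spin_monomial:
  assumes graph: "finite_graph V E" and J: "\<forall>e\<in>E. 0 < J e"
  shows "xy_expectation V E J (\<lambda>\<sigma>. Re (spin_monomial V \<phi> \<sigma>)) * xy_expectation V E J (\<lambda>\<sigma>. Re (spin_monomial V \<psi> \<sigma>))
    \<le> xy_expectation V E J (\<lambda>\<sigma>. Re (spin_monomial V \<phi> \<sigma>) * Re (spin_monomial V \<psi> \<sigma>))"
proof -
  let ?M = "spin_uniform V"
  define w where "w = (\<lambda>\<sigma>. exp (- xy_hamiltonian E J \<sigma>))"
  define A where "A = (\<lambda>\<sigma>. Re (spin_monomial V \<phi> \<sigma>))"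
  define B where "B = (\<lambda>\<sigma>. Re (spin_monomial V \<psi> \<sigma>))"
  define g where "g = (\<lambda>\<sigma>. Im (spin_monomial V \<phi> \<sigma>) * Im (spin_monomial V \<psi> \<sigma>))"
  define F where "F = (\<lambda>\<sigma> \<tau>. (A \<sigma> - A \<tau>) * (B \<sigma> - B \<tau>) * (w \<sigma> * w \<tau>))"
  define C where "C = exp (\<Sum>e\<in>E. \<bar>J e\<bar>)"
  interpret prob_space ?M by (rule prob_space_spin_uniform)
  interpret P: pair_prob_space ?M ?M ..
  have V: "finite V" using graph by (simp add: finite_graph_def)
  have [measurable]: "w \<in> borel_measurable ?M" "A \<in> borel_measurable ?M" "B \<in> borel_measurable ?M"
      "g \<in> borel_measurable ?M"
    using xy_hamiltonian_measurable[OF graph, of J] by (auto simp: w_def A_def B_def g_def)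
  have A1: "\<bar>A \<sigma>\<bar> \<le> 1" and B1: "\<bar>B \<sigma>\<bar> \<le> 1" and g1: "\<bar>g \<sigma>\<bar> \<le> 1" and w1: "\<bar>w \<sigma>\<bar> \<le> C"
    if "\<sigma> \<in> space ?M" for \<sigma>
    using abs_Re_le_cmod[of "spin_monomial V \<phi> \<sigma>"] abs_Re_le_cmod[of "spin_monomial V \<psi> \<sigma>"]
      abs_Im_le_cmod[of "spin_monomial V \<phi> \<sigma>"] abs_Im_le_cmod[of "spin_monomial V \<psi> \<sigma>"]
      norm_spin_monomial[OF that] xy_boltzmann_bounds(2)[OF graph that, of J]
    by (auto simp: A_def B_def g_def w_def C_def abs_mult intro!: mult_le_one)
  have AB1: "\<bar>A \<sigma> * B \<sigma>\<bar> \<le> 1" if "\<sigma> \<in> space ?M" for \<sigma>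
    using A1[OF that] B1[OF that] by (auto simp: abs_mult intro!: mult_le_one)
  have int: "integrable ?M (\<lambda>\<sigma>. f \<sigma> * w \<sigma>)"
    if [measurable]: "f \<in> borel_measurable ?M" and f1: "\<And>\<sigma>. \<sigma> \<in> space ?M \<Longrightarrow> \<bar>f \<sigma>\<bar> \<le> 1" for f
  proof (rule integrable_const_bound[where B = "1 * C"])
    show "AE \<sigma> in ?M. norm (f \<sigma> * w \<sigma>) \<le> 1 * C"
      unfolding real_norm_def abs_mult
      by (intro AE_I2 mult_mono f1 w1) auto
  qed measurable
  have F_meas: "case_prod F \<in> borel_measurable (?M \<Otimes>\<^sub>M ?M)"
    unfolding F_def by measurable
  have F_bound: "\<bar>F \<sigma> \<tau>\<bar> \<le> 2 * 2 * (C * C)" if "\<sigma> \<in> space ?M" "\<tau> \<in> space ?M" for \<sigma> \<tau>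
  proof -
    have "\<bar>A \<sigma> - A \<tau>\<bar> \<le> 2" "\<bar>B \<sigma> - B \<tau>\<bar> \<le> 2"
      using A1 B1 that by (smt (verit))+
    then show ?thesis
      unfolding F_def abs_mult using that by (intro mult_mono w1) (auto simp: C_def)
  qed
  \<comment> \<open>The factor 2 in the coefficients is that of
    \<open>edge_inner_times_add_times_cnj\<close>; positivity of \<open>J\<close> is what makes the
    kernel results applicable.\<close>
  have exp_kernel:
    "integrable (?M \<Otimes>\<^sub>M ?M)
      (\<lambda>p. g (fst p) * g (snd p) * exp (pair_kernel E (\<lambda>e. 2 * J e) (\<lambda>e \<sigma>. edge_inner \<sigma> e) p))"
    "0 \<le> (\<integral>p. g (fst p) * g (snd p) * exp (pair_kernel E (\<lambda>e. 2 * J e) (\<lambda>e \<sigma>. edge_inner \<sigma> e) p)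
      \<partial>(?M \<Otimes>\<^sub>M ?M))"
    using J g1 finite_graph_finite_edges[OF graph] edge_inner_measurable[OF graph]
      abs_edge_inner_le_1[OF graph]
    by (auto intro!: integrable_exp_pair_kernel integral_exp_pair_kernel_nonneg simp: less_imp_le)
  have "(\<integral>p. F (fst p) (snd p) \<partial>(?M \<Otimes>\<^sub>M ?M)) =
      2 * ((\<integral>x. w x \<partial>?M) * (\<integral>x. A x * B x * w x \<partial>?M) - (\<integral>x. A x * w x \<partial>?M) * (\<integral>x. B x * w x \<partial>?M))"
    unfolding F_def using int[of "\<lambda>_. 1"] int[of A] int[of B] int[of "\<lambda>x. A x * B x"] A1 B1 AB1
    by (intro covariance_by_duplication prob_space_spin_uniform) auto
  also have "(\<integral>p. F (fst p) (snd p) \<partial>(?M \<Otimes>\<^sub>M ?M)) = (\<integral>\<sigma>. \<integral>\<tau>. F \<sigma> \<tau> \<partial>?M \<partial>?M)"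
    using F_meas F_bound
    by (subst P.integral_fst'[symmetric])
      (auto intro!: P.integrable_const_bound[where B = "2 * 2 * (C * C)"] AE_I2 simp: space_pair_measure case_prod_beta')
  also have "\<dots> = (\<integral>\<sigma>. \<integral>\<tau>. F (\<lambda>x\<in>V. \<sigma> x * \<tau> x) (\<lambda>x\<in>V. \<sigma> x * cnj (\<tau> x)) \<partial>?M \<partial>?M)"
    using F_bound by (intro integral_spin_sum_difference[symmetric] V F_meas)
  also have "\<dots> = (\<integral>\<sigma>. \<integral>\<tau>. 4 * (g \<sigma> * g \<tau> * exp (pair_kernel E (\<lambda>e. 2 * J e) (\<lambda>e \<sigma>. edge_inner \<sigma> e) (\<sigma>, \<tau>))) \<partial>?M \<partial>?M)"
  proof -
    have "w (\<lambda>x\<in>V. \<sigma> x * \<tau> x) * w (\<lambda>x\<in>V. \<sigma> x * cnj (\<tau> x)) =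
        exp (pair_kernel E (\<lambda>e. 2 * J e) (\<lambda>e \<sigma>. edge_inner \<sigma> e) (\<sigma>, \<tau>))" for \<sigma> \<tau>
    proof -
      have "- xy_hamiltonian E J (\<lambda>x\<in>V. \<sigma> x * \<tau> x) + - xy_hamiltonian E J (\<lambda>x\<in>V. \<sigma> x * cnj (\<tau> x)) =
          (\<Sum>e\<in>E. J e * (edge_inner (\<lambda>x\<in>V. \<sigma> x * \<tau> x) e + edge_inner (\<lambda>x\<in>V. \<sigma> x * cnj (\<tau> x)) e))"
        by (simp add: xy_hamiltonian_def sum.distrib distrib_left)
      also have "\<dots> = pair_kernel E (\<lambda>e. 2 * J e) (\<lambda>e \<sigma>. edge_inner \<sigma> e) (\<sigma>, \<tau>)"
        unfolding pair_kernel_def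
        by (intro sum.cong refl) (simp add: edge_inner_times_add_times_cnj[OF graph])
      finally show ?thesis
        unfolding w_def exp_add[symmetric] by simp
    qed
    then show ?thesis
      \<comment> \<open>For the monomials a of \<sigma> and b of \<tau>, Re (a b) - Re (a
        \<open>cnj\<close> b) = -2 Im a Im b. Both differences in \<open>F\<close> have this form,
        so the signs cancel and 4 times \<open>g\<close> at \<sigma> times \<open>g\<close> at
        \<tau> remains.\<close>
      unfolding F_def A_def B_def g_def spin_monomial_times_cnj
      unfolding spin_monomial_times
      by (simp add: algebra_simps)
  qed
  also have "\<dots> = 4 * (\<integral>p. g (fst p) * g (snd p) * exp (pair_kernel E (\<lambda>e. 2 * J e) (\<lambda>e \<sigma>. edge_inner \<sigma> e) p) \<partial>(?M \<Otimes>\<^sub>M ?M))"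
    by (subst P.integral_fst'[OF exp_kernel(1), symmetric]) simp
  finally have le: "(\<integral>x. A x * w x \<partial>?M) * (\<integral>x. B x * w x \<partial>?M) \<le> (\<integral>x. w x \<partial>?M) * (\<integral>x. A x * B x * w x \<partial>?M)"
    using exp_kernel(2) by simp
  have E: "xy_expectation V E J f = (\<integral>x. f x * w x \<partial>?M) / (\<integral>x. w x \<partial>?M)"
    if "f \<in> borel_measurable ?M" for f :: "('a \<Rightarrow> complex) \<Rightarrow> real"
    using xy_expectation_eq[OF graph that] by (simp add: w_def xy_partition_def mult.commute divide_inverse)
  have Z: "0 < (\<integral>x. w x \<partial>?M)"
    using xy_partition_pos[OF graph, of J] by (simp add: xy_partition_def w_def)
  \<comment> \<open>Dividing \<open>le\<close> by the square of the partition function turns the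
    weighted integrals into expectations.\<close>
  have "xy_expectation V E J A * xy_expectation V E J B \<le> xy_expectation V E J (\<lambda>x. A x * B x)"
    using le Z by (simp add: E field_simps)
  then show ?thesis
    by (simp add: A_def B_def)
qed

theorem theorem1:
  fixes V :: "'v set" and E :: "'v set set" and J :: "'v set \<Rightarrow> real"
    and \<phi> \<psi> :: "'v \<Rightarrow> int"
  assumes "finite_graph V E"
    and "\<forall>e\<in>E. 0 < J e"
    and "(\<Sum>v\<in>V. \<phi> v) = 0" and "(\<Sum>v\<in>V. \<psi> v) = 0"
  shows "xy_expectation V E J (spin_monomial V (\<lambda>v. \<phi> v + \<psi> v))
           + xy_expectation V E J (spin_monomial V (\<lambda>v. \<phi> v - \<psi> v))
         \<ge> 2 * xy_expectation V E J (spin_monomial V \<phi>) * xy_expectation V E J (spin_monomial V \<psi>)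
       \<and> xy_expectation V E J (\<lambda>\<sigma>. cos (angle_pairing V \<phi> \<sigma>) * cos (angle_pairing V \<psi> \<sigma>))
         \<ge> xy_expectation V E J (\<lambda>\<sigma>. cos (angle_pairing V \<phi> \<sigma>))
             * xy_expectation V E J (\<lambda>\<sigma>. cos (angle_pairing V \<psi> \<sigma>))"
proof -
  let ?E = "xy_expectation V E J"
  let ?A = "\<lambda>\<sigma>. Re (spin_monomial V \<phi> \<sigma>)" and ?B = "\<lambda>\<sigma>. Re (spin_monomial V \<psi> \<sigma>)"
  have ginibre: "?E ?A * ?E ?B \<le> ?E (\<lambda>\<sigma>. ?A \<sigma> * ?B \<sigma>)"
    using assms(1,2) by (rule ginibre_spin_monomial)
  have int: "integrable (xy_gibbs V E J) (\<lambda>\<sigma>. Re (spin_monomial V \<eta> \<sigma>))" for \<eta>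
    using norm_spin_monomial[of _ V \<eta>] abs_Re_le_cmod[of "spin_monomial V \<eta> _"]
    by (intro integrable_xy_gibbs[OF assms(1), where B = 1]) (auto, metis)
  have "?E (\<lambda>\<sigma>. Re (spin_monomial V (\<lambda>v. \<phi> v + \<psi> v) \<sigma>)) + ?E (\<lambda>\<sigma>. Re (spin_monomial V (\<lambda>v. \<phi> v - \<psi> v) \<sigma>)) =
      ?E (\<lambda>\<sigma>. Re (spin_monomial V (\<lambda>v. \<phi> v + \<psi> v) \<sigma>) + Re (spin_monomial V (\<lambda>v. \<phi> v - \<psi> v) \<sigma>))"
    unfolding xy_expectation_def by (intro Bochner_Integration.integral_add[symmetric] int)
  \<comment> \<open>Again Re (a b) + Re (a \<open>cnj\<close> b) = 2 Re a Re b, now for the two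
    monomials at one configuration; this makes the complex form a consequence of the cosine
    form.\<close>
  also have "\<dots> = ?E (\<lambda>\<sigma>. 2 * (?A \<sigma> * ?B \<sigma>))"
    by (rule xy_expectation_cong) (simp add: spin_monomial_add spin_monomial_diff)
  also have "\<dots> = 2 * ?E (\<lambda>\<sigma>. ?A \<sigma> * ?B \<sigma>)"
    unfolding xy_expectation_def by simp
  finally have Re: "Re (?E (spin_monomial V (\<lambda>v. \<phi> v + \<psi> v)) + ?E (spin_monomial V (\<lambda>v. \<phi> v - \<psi> v))) =
      2 * ?E (\<lambda>\<sigma>. ?A \<sigma> * ?B \<sigma>)"
    by (simp add: Re_xy_expectation_spin_monomial[OF assms(1)])
  have "2 * ?E (spin_monomial V \<phi>) * ?E (spin_monomial V \<psi>) \<le>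
      ?E (spin_monomial V (\<lambda>v. \<phi> v + \<psi> v)) + ?E (spin_monomial V (\<lambda>v. \<phi> v - \<psi> v))"
    \<comment> \<open>The order on complex numbers also demands equal imaginary parts; those of all
      the expectations vanish by conjugation symmetry.\<close>
    unfolding less_eq_complex_def Re
    using ginibre
    by (simp add: Im_xy_expectation_spin_monomial[OF assms(1)] Re_xy_expectation_spin_monomial[OF assms(1)])
  moreover have "?E (\<lambda>\<sigma>. cos (angle_pairing V \<phi> \<sigma>)) * ?E (\<lambda>\<sigma>. cos (angle_pairing V \<psi> \<sigma>)) \<le>
      ?E (\<lambda>\<sigma>. cos (angle_pairing V \<phi> \<sigma>) * cos (angle_pairing V \<psi> \<sigma>))"
    using ginibre by (simp add: cos_angle_pairing cong: xy_expectation_cong)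
  ultimately show ?thesis
    by simp
qed

end
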